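(* For any constant $\varepsilon>0$, there is some integer $n$ and a graph $G$ on $n$ vertices for which $m(G)-\chi(G)>(1-\varepsilon)n$.
   Context: All graphs are finite and simple. $\chi(G)$ is the usual chromatic number. The marking game on a graph $G=(V,E)$ with parameter $k$: two players, Maker and Breaker, move alternately, Maker first, each turn marking one unmarked vertex of $G$ by adding it to a set $M$ (initially empty). A vertex may only be marked if it has at most $k-1$ marked neighbours. Maker wins if eventually $M=V$, whereas Breaker wins if some vertex becomes impossible to mark. The marking number $m(G)$ (also called the game colouring number) is the minimal $k$ for which Maker can win the marking game on $G$. *)

theory Defs
  imports Complex_Main "Graph_Theory.Pair_Digraph"
begin

text \<open>
  A finite simple graph is a \<^locale>\<open>pair_graph\<close>: a finite, loop-free, symmetric set of ordered
  pairs over a finite vertex set, so an edge \<open>uv\<close> is present as both \<open>(u, v)\<close> and \<open>(v, u)\<close>.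
\<close>

definition proper_coloring :: "'a pair_pre_digraph \<Rightarrow> nat \<Rightarrow> ('a \<Rightarrow> nat) \<Rightarrow> bool" where
  "proper_coloring G c f \<longleftrightarrow>
     (\<forall>v \<in> pverts G. f v < c) \<and> (\<forall>(u, v) \<in> parcs G. f u \<noteq> f v)"

definition chromatic_number :: "'a pair_pre_digraph \<Rightarrow> nat" where
  "chromatic_number G = (LEAST c. \<exists>f. proper_coloring G c f)"

definition marked_neighbours :: "'a pair_pre_digraph \<Rightarrow> 'a set \<Rightarrow> 'a \<Rightarrow> 'a set" where
  "marked_neighbours G M v = {u \<in> M. (u, v) \<in> parcs G}"

text \<open>``At most \<open>k - 1\<close>'' is written \<open>< k\<close>, since \<open>k - 1\<close> on \<^typ>\<open>nat\<close> would truncate at \<open>k = 0\<close>.\<close>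

definition markable :: "'a pair_pre_digraph \<Rightarrow> nat \<Rightarrow> 'a set \<Rightarrow> 'a \<Rightarrow> bool" where
  "markable G k M v \<longleftrightarrow> v \<in> pverts G \<and> v \<notin> M \<and> card (marked_neighbours G M v) < k"

datatype player = Maker | Breaker

text \<open>
  \<open>maker_wins G k p M\<close>: Maker has a winning strategy from the position in which \<open>M\<close> is the set of
  marked vertices and \<open>p\<close> is to move. Breaker's win needs no rule of its own: an unmarked vertex
  with \<open>k\<close> marked neighbours stays unmarkable, so \<open>M = V\<close> is then out of reach (lemma
  \<open>not_maker_wins_if_stuck\<close>). The first premise of \<open>breaker_move\<close> excludes a vacuous Maker win
  in a position without legal moves.
\<close>

inductive maker_wins :: "'a pair_pre_digraph \<Rightarrow> nat \<Rightarrow> player \<Rightarrow> 'a set \<Rightarrow> bool"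
  for G k where
  all_marked: "maker_wins G k p (pverts G)"
| maker_move: "markable G k M v \<Longrightarrow> maker_wins G k Breaker (insert v M) \<Longrightarrow> maker_wins G k Maker M"
| breaker_move: "\<exists>v. markable G k M v \<Longrightarrow>
    (\<And>v. markable G k M v \<Longrightarrow> maker_wins G k Maker (insert v M)) \<Longrightarrow> maker_wins G k Breaker M"

definition marking_number :: "'a pair_pre_digraph \<Rightarrow> nat" where
  "marking_number G = (LEAST k. maker_wins G k Maker {})"

lemma not_maker_wins_if_stuck:
  assumes "finite (pverts G)" "M \<subseteq> pverts G"
    and "v \<in> pverts G" "v \<notin> M" "card (marked_neighbours G M v) \<ge> k"
  shows "\<not> maker_wins G k p M"
proof -
  have step: "insert w N \<subseteq> pverts G \<and> v \<notin> insert w N \<and> k \<le> card (marked_neighbours G (insert w N) v)"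
    if "N \<subseteq> pverts G" "v \<notin> N" "k \<le> card (marked_neighbours G N v)" "markable G k N w" for N w
  proof -
    have "finite (marked_neighbours G (insert w N) v)"
      using finite_subset[OF that(1) assms(1)] unfolding marked_neighbours_def by simp
    moreover have "marked_neighbours G N v \<subseteq> marked_neighbours G (insert w N) v"
      unfolding marked_neighbours_def by blast
    ultimately have "card (marked_neighbours G N v) \<le> card (marked_neighbours G (insert w N) v)"
      by (rule card_mono)
    then show ?thesis using that unfolding markable_def by auto
  qed
  have "False" if "maker_wins G k p N" "N \<subseteq> pverts G" "v \<notin> N" "k \<le> card (marked_neighbours G N v)"
    for p N
    using that
  proof (induction rule: maker_wins.induct)
    case (all_marked p)
    then show ?case using assms(3) by blast
  next
    case (maker_move M w)
    from step[OF maker_move.prems maker_move.hyps(1)] maker_move.IH show ?case by simp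
  next
    case (breaker_move M)
    from breaker_move.hyps(1) obtain w where w: "markable G k M w" by (elim exE)
    from step[OF breaker_move.prems w] breaker_move.IH[OF w] show ?case by simp
  qed
  then show ?thesis using assms by blast
qed

text \<open>Both minima are attained, so the \<open>LEAST\<close> operators are meaningful.\<close>

lemma maker_wins_card:
  assumes "finite (pverts G)" "M \<subseteq> pverts G"
  shows "maker_wins G (card (pverts G)) p M"
proof (cases "M = pverts G")
  case True
  then show ?thesis using all_marked by metis
next
  case False
  have free: "markable G (card (pverts G)) N v"
    if "N \<subseteq> pverts G" "v \<in> pverts G" "v \<notin> N" for N v
  proof -
    have "marked_neighbours G N v \<subset> pverts G"
      using that unfolding marked_neighbours_def by blast
    then show ?thesis
      using that psubset_card_mono[OF assms(1)] unfolding markable_def by blast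
  qed
  show ?thesis using assms(2)
  proof (induction "card (pverts G - M)" arbitrary: M p rule: less_induct)
    case less
    show ?case
    proof (cases "M = pverts G")
      case True
      then show ?thesis using all_marked by metis
    next
      case False
      then obtain v where v: "markable G (card (pverts G)) M v"
        using free less.prems by blast
      have IH: "maker_wins G (card (pverts G)) q (insert w M)"
        if "markable G (card (pverts G)) M w" for q w
      proof (rule less.hyps)
        show "card (pverts G - insert w M) < card (pverts G - M)"
          using that assms(1) unfolding markable_def by (intro psubset_card_mono) auto
        show "insert w M \<subseteq> pverts G" using that less.prems unfolding markable_def by blast
      qed
      show ?thesis
      proof (cases p)
        case Maker
        then show ?thesis using maker_move[OF v IH[OF v]] by simp
      next
        case Breaker
        have "maker_wins G (card (pverts G)) Breaker M"
          by (rule breaker_move) (use v in \<open>rule exI\<close>, rule IH)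
        then show ?thesis using Breaker by simp
      qed
    qed
  qed
qed

lemma maker_wins_marking_number:
  assumes "pair_graph G"
  shows "maker_wins G (marking_number G) Maker {}"
proof -
  interpret pair_graph G by (rule assms)
  show ?thesis unfolding marking_number_def
    by (rule LeastI) (rule maker_wins_card[OF pair_finite_verts empty_subsetI])
qed

lemma proper_coloring_chromatic_number:
  assumes "pair_graph G"
  shows "\<exists>f. proper_coloring G (chromatic_number G) f"
proof -
  interpret pair_graph G by (rule assms)
  obtain f :: "'a \<Rightarrow> nat" and c where f: "f ` pverts G = {i. i < c}" "inj_on f (pverts G)"
    using finite_imp_inj_to_nat_seg[OF pair_finite_verts] by blast
  have "f u \<noteq> f v" if "(u, v) \<in> parcs G" for u v
    using inj_onD[OF f(2) _ in_arcsD1[OF that] in_arcsD2[OF that]] pair_no_loops[OF that] by auto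
  then have "proper_coloring G c f"
    using f(1) unfolding proper_coloring_def by auto
  then have "\<exists>c f. proper_coloring G c f" by blast
  from LeastI_ex[OF this] show ?thesis unfolding chromatic_number_def .
qed

end

theory Submission
  imports Defs
begin

text \<open>
  Maker cannot win before the last vertex is marked, and at that moment all neighbours of this
  vertex are already marked, whoever moves and however the game was played. So the marking number
  exceeds the minimum degree (\<open>marking_number_greater_min_degree\<close>).

  It therefore suffices to find graphs of minimum degree close to \<open>n\<close> and chromatic number \<open>o(n)\<close>.
  The complete multipartite graph with \<open>s\<close> parts of size \<open>s\<close> has \<open>n = s\<^sup>2\<close> vertices, is regular of
  degree \<open>s\<^sup>2 - s\<close> and is coloured by its parts, whence \<open>m - \<chi> \<ge> s\<^sup>2 - 2 s + 1\<close>. This is more than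
  \<open>(1 - \<epsilon>) s\<^sup>2\<close> once \<open>s > 2 / \<epsilon>\<close>. Taking both the number and the size of the parts to be \<open>\<surd>n\<close>
  balances the two losses: the part size in the degree, the number of parts in the chromatic number.
\<close>

text \<open>
  A win is a finite play that marks every vertex, so any branch of Maker's strategy can be followed
  to its last move; that move is the one that marks a vertex with all its neighbours marked.
\<close>

lemma maker_wins_imp_min_degree_less:
  assumes "pair_graph G"
    and degree: "\<And>v. v \<in> pverts G \<Longrightarrow> d \<le> card (marked_neighbours G (pverts G) v)"
    and "maker_wins G k p M" "M \<subset> pverts G"
  shows "d < k"
proof -
  interpret pair_graph G by (rule assms(1))
  have last_move: "d < k" if v: "markable G k M v" and full: "insert v M = pverts G" for M v
  proof -
    have "marked_neighbours G M v = marked_neighbours G (pverts G) v"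
      using pair_no_loops[of "(v, v)"] unfolding marked_neighbours_def full[symmetric] by auto
    then show ?thesis using v degree[of v] unfolding markable_def by auto
  qed
  have extend: "insert v M = pverts G \<or> insert v M \<subset> pverts G"
    if "markable G k M v" "M \<subset> pverts G" for M v
    using that unfolding markable_def by blast
  show ?thesis using assms(3,4)
  proof (induction rule: maker_wins.induct)
    case (all_marked p)
    then show ?case by simp
  next
    case (maker_move M v)
    from extend[OF maker_move.hyps(1) maker_move.prems] show ?case
      using last_move[OF maker_move.hyps(1)] maker_move.IH by (elim disjE)
  next
    case (breaker_move M)
    from breaker_move.hyps(1) obtain v where v: "markable G k M v" by (elim exE)
    from extend[OF v breaker_move.prems] show ?case
      using last_move[OF v] breaker_move.IH[OF v] by (elim disjE)
  qed
qed

lemma marking_number_greater_min_degree: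
  assumes "pair_graph G" "pverts G \<noteq> {}"
    and "\<And>v. v \<in> pverts G \<Longrightarrow> d \<le> card (marked_neighbours G (pverts G) v)"
  shows "d < marking_number G"
  using assms(2) maker_wins_imp_min_degree_less[OF assms(1,3) maker_wins_marking_number[OF assms(1)]]
  by blast

lemma chromatic_number_le:
  assumes "proper_coloring G c f"
  shows "chromatic_number G \<le> c"
  unfolding chromatic_number_def using assms by (blast intro: Least_le)

text \<open>The parts of this complete multipartite graph are the \<open>s\<close> residue classes modulo \<open>s\<close>.\<close>

definition square_multipartite :: "nat \<Rightarrow> nat pair_pre_digraph" where
  "square_multipartite s =
     \<lparr>pverts = {..<s * s},
      parcs = {(u, v). u < s * s \<and> v < s * s \<and> u mod s \<noteq> v mod s}\<rparr>"

lemma pverts_square_multipartite [simp]: "pverts (square_multipartite s) = {..<s * s}"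
  by (simp add: square_multipartite_def)

lemma in_parcs_square_multipartite [simp]:
  "(u, v) \<in> parcs (square_multipartite s) \<longleftrightarrow> u < s * s \<and> v < s * s \<and> u mod s \<noteq> v mod s"
  by (simp add: square_multipartite_def)

lemma pair_graph_square_multipartite: "pair_graph (square_multipartite s)"
proof
  show "finite (parcs (square_multipartite s))"
    by (rule finite_subset[of _ "{..<s * s} \<times> {..<s * s}"]) auto
  show "symmetric (square_multipartite s)"
    by (auto simp: symmetric_def intro!: symI)
qed auto

lemma chromatic_number_square_multipartite_le:
  assumes "0 < s"
  shows "chromatic_number (square_multipartite s) \<le> s"
  by (rule chromatic_number_le[where f = "\<lambda>v. v mod s"])
    (use assms in \<open>auto simp: proper_coloring_def\<close>)

lemma degree_square_multipartite_ge:
  assumes "v < s * s"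
  shows "s * s - s \<le> card (marked_neighbours (square_multipartite s) {..<s * s} v)"
proof -
  define part where "part = {u \<in> {..<s * s}. u mod s = v mod s}"
  \<comment> \<open>An element of a residue class is determined by its quotient, which takes \<open>s\<close> values.\<close>
  have "inj_on (\<lambda>u. u div s) part"
  proof (rule inj_onI)
    fix u w
    assume "u \<in> part" "w \<in> part" and quotient: "u div s = w div s"
    then have "u mod s = w mod s" unfolding part_def by simp
    then show "u = w" using quotient by (metis div_mult_mod_eq)
  qed
  moreover have "(\<lambda>u. u div s) ` part \<subseteq> {..<s}"
    unfolding part_def by (auto simp: less_mult_imp_div_less)
  ultimately have "card part \<le> s"
    using card_inj_on_le[of _ part "{..<s}"] by simp
  moreover have "marked_neighbours (square_multipartite s) {..<s * s} v = {..<s * s} - part"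
    using assms unfolding marked_neighbours_def part_def by auto
  moreover have "card ({..<s * s} - part) = s * s - card part"
    unfolding part_def by (subst card_Diff_subset) auto
  ultimately show ?thesis by simp
qed

theorem theorem4p2:
  fixes \<epsilon> :: real
  assumes "\<epsilon> > 0"
  shows "\<exists>(n :: nat) (G :: nat pair_pre_digraph).
           pair_graph G \<and> card (pverts G) = n \<and>
           real (marking_number G) - real (chromatic_number G) > (1 - \<epsilon>) * real n"
proof -
  obtain s :: nat where s: "2 / \<epsilon> < real s"
    using reals_Archimedean2 by blast
  then have "0 < real s" using assms divide_pos_pos[of 2 \<epsilon>] by linarith
  then have pos: "0 < s" by simp
  let ?G = "square_multipartite s"
  have "s * s - s < marking_number ?G"
  proof (rule marking_number_greater_min_degree[OF pair_graph_square_multipartite])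
    show "pverts ?G \<noteq> {}" using pos by (simp add: lessThan_empty_iff)
    show "s * s - s \<le> card (marked_neighbours ?G (pverts ?G) v)" if "v \<in> pverts ?G" for v
      using that degree_square_multipartite_ge[of v s] by simp
  qed
  then have "s * s < marking_number ?G + s"
    by simp
  then have marking: "real s * real s < real (marking_number ?G) + real s"
    by (simp flip: of_nat_mult of_nat_add)
  have chromatic: "real (chromatic_number ?G) \<le> real s"
    using chromatic_number_square_multipartite_le[OF pos] by simp
  have "2 < \<epsilon> * real s"
    using s assms by (simp add: field_simps)
  then have "2 * real s < \<epsilon> * real s * real s"
    using pos by simp
  then have "(1 - \<epsilon>) * real (s * s) < real (marking_number ?G) - real (chromatic_number ?G)"
    using marking chromatic by (simp add: algebra_simps)
  then show ?thesis
    using pair_graph_square_multipartite[of s] by (intro exI[of _ "s * s"] exI[of _ ?G]) simp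
qed

end
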